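(* Let $X$ be a locally convex Hausdorff real topological vector space, let $(f_i)_{i\in I}$ be a family of proper functions $f_i:X\to\mathbb R\cup\{+\infty\}$ whose robust sum $f$ is proper, and let $\overline{x}^*\in X^*$. Let $(J,(x_j^* )_{j\in J})\in\mathbb F(\overline{x}^* )$ and assume that $\min(\mathrm{RP}_{\overline{x}^*})=\sup(\mathrm{RD}_{\overline{x}^*})$. The following statements are equivalent: (i) $(J,(x_j^* )_{j\in J})\in\operatorname{sol}(\mathrm{RD}_{\overline{x}^*})$. (ii) For all $x\in\operatorname{sol}(\mathrm{RP}_{\overline{x}^*})$ one has $J\in S_f(x)$ and $x_j^*\in\partial f_j(x)$ for all $j\in J$. (iii) There exists $x\in\operatorname{sol}(\mathrm{RP}_{\overline{x}^*})$ such that $J\in S_f(x)$ and $x_j^*\in\partial f_j(x)$ for all $j\in J$. (iv) There exists $x\in X$ such that $J\in S_f(x)$ and $x_j^*\in\partial f_j(x)$ for all $j\in J$. Moreover, for every $x\in\operatorname{sol}(\mathrm{RP}_{\overline{x}^*})$ (hence for some $x\in\operatorname{sol}(\mathrm{RP}_{\overline{x}^*})$, and for some $x\in X$) one has $$\operatorname{sol}(\mathrm{RD}_{\overline{x}^*})=\big\{(K,(y_j^* )_{j\in K})\in\mathbb F(\overline{x}^* ): K\in S_f(x)\text{ and }y_j^*\in\partial f_j(x)\ \forall j\in K\big\}.$$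
   Context: $X^*$ is the topological dual of $X$ and $\langle x^*,x\rangle$ the duality pairing. $I$ is an infinite index set and $\mathcal F(I)$ is the collection of all nonempty finite subsets of $I$. The robust sum is $f(x)=\sum_{i\in I}^R f_i(x):=\sup_{J\in\mathcal F(I)}\sum_{i\in J}f_i(x)$. For $h:X\to\overline{\mathbb R}$, $\operatorname{dom}h=\{x:h(x)<+\infty\}$, $h^*(x^* )=\sup_{x\in X}\{\langle x^*,x\rangle-h(x)\}$, and $\partial h(a)=\{x^*\in X^*: h(x)\ge h(a)+\langle x^*,x-a\rangle\ \forall x\in X\}$ if $h(a)\in\mathbb R$, $\partial h(a)=\emptyset$ otherwise. Feasible dual set: $\mathbb F(\overline{x}^* )=\{(J,(x_j^* )_{j\in J}): J\in\mathcal F(I),\ (x_j^* )_{j\in J}\in(X^* )^J,\ \sum_{j\in J}x_j^*=\overline{x}^*\}$. Primal problem $(\mathrm{RP}_{\overline{x}^*})$: $\inf\{f(x)-\langle\overline{x}^*,x\rangle:x\in X\}$. Dual problem $(\mathrm{RD}_{\overline{x}^*})$: $\sup\{-\sum_{j\in J}f_j^*(x_j^* ):(J,(x_j^* )_{j\in J})\in\mathbb F(\overline{x}^* )\}$. $\operatorname{sol}(\mathrm{RP}_{\overline{x}^*})=\{x\in X: f(x)-\langle\overline{x}^*,x\rangle=\inf(\mathrm{RP}_{\overline{x}^*})\}$ and $\operatorname{sol}(\mathrm{RD}_{\overline{x}^*})=\{(J,(x_j^* )_{j\in J})\in\mathbb F(\overline{x}^* ): -\sum_{j\in J}f_j^*(x_j^*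 )=\sup(\mathrm{RD}_{\overline{x}^*})\}$. Writing $\min(\mathrm{RP}_{\overline{x}^*})$ instead of $\inf(\mathrm{RP}_{\overline{x}^*})$ means that $\operatorname{sol}(\mathrm{RP}_{\overline{x}^*})\neq\emptyset$; so $\min(\mathrm{RP}_{\overline{x}^*})=\sup(\mathrm{RD}_{\overline{x}^*})$ means that the two optimal values coincide and $\operatorname{sol}(\mathrm{RP}_{\overline{x}^*})\ne\emptyset$. For $x\in X$: $S_f(x)=\{J\in\mathcal F(I):\sum_{j\in J}f_j(x)=f(x)\}$ if $x\in\operatorname{dom}f$, and $S_f(x)=\emptyset$ otherwise. *)

theory Defs
  imports "HOL-Analysis.Analysis"
begin

text \<open>
  Locally convex Hausdorff real topological vector spaces. Continuity of addition and negation is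
  part of \<^class>\<open>topological_ab_group_add\<close>; joint continuity of scalar multiplication is phrased
  in the same filter style. By translation invariance it is enough to ask for small convex
  neighbourhoods at the origin. The constant \<^const>\<open>convex\<close> cannot be used inside a class
  specification, so its definition is written out there.
\<close>

class locally_convex_space = real_vector + topological_ab_group_add + t2_space +
  assumes tendsto_scaleR_nhds:
    "((\<lambda>p. fst p *\<^sub>R snd p) \<longlongrightarrow> c *\<^sub>R x) (nhds c \<times>\<^sub>F nhds x)"
  assumes small_convex_neighbourhood:
    "open U \<Longrightarrow> 0 \<in> U \<Longrightarrow>
      \<exists>V. open V \<and> 0 \<in> V \<and> V \<subseteq> U \<and>
        (\<forall>x\<in>V. \<forall>y\<in>V. \<forall>u\<ge>0. \<forall>v\<ge>0. u + v = 1 \<longrightarrow> u *\<^sub>R x + v *\<^sub>R y \<in> V)"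

lemma locally_convex_space_convex_nhd:
  fixes U :: "'a::locally_convex_space set"
  assumes "open U" "0 \<in> U"
  shows "\<exists>V. open V \<and> 0 \<in> V \<and> V \<subseteq> U \<and> convex V"
  using small_convex_neighbourhood[OF assms] by (simp add: convex_def)

instance real_normed_vector \<subseteq> locally_convex_space
proof
  fix c :: real and x :: 'a
  show "((\<lambda>p. fst p *\<^sub>R snd p) \<longlongrightarrow> c *\<^sub>R x) (nhds c \<times>\<^sub>F nhds x)"
    by (intro tendsto_intros filterlim_fst filterlim_snd)
next
  fix U :: "'a set" assume "open U" "0 \<in> U"
  then obtain e where "e > 0" "ball 0 e \<subseteq> U"
    by (meson open_contains_ball)
  then show "\<exists>V. open V \<and> 0 \<in> V \<and> V \<subseteq> U \<and>
      (\<forall>x\<in>V. \<forall>y\<in>V. \<forall>u\<ge>0. \<forall>v\<ge>0. u + v = 1 \<longrightarrow> u *\<^sub>R x + v *\<^sub>R y \<in> V)"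
    unfolding convex_def[symmetric] by (intro exI[of _ "ball 0 e"]) auto
qed

definition topological_dual :: "('a::locally_convex_space \<Rightarrow> real) set" where
  "topological_dual = {l. linear l \<and> continuous_on UNIV l}"

definition eff_domain :: "('a \<Rightarrow> ereal) \<Rightarrow> 'a set" where
  "eff_domain h = {x. h x < \<infinity>}"

definition proper_function :: "('a \<Rightarrow> ereal) \<Rightarrow> bool" where
  "proper_function h \<longleftrightarrow> (\<forall>x. h x \<noteq> -\<infinity>) \<and> eff_domain h \<noteq> {}"

definition conjugate :: "('a::locally_convex_space \<Rightarrow> ereal) \<Rightarrow> ('a \<Rightarrow> real) \<Rightarrow> ereal" where
  "conjugate h l = (SUP x. ereal (l x) - h x)"

definition subdifferential ::
    "('a::locally_convex_space \<Rightarrow> ereal) \<Rightarrow> 'a \<Rightarrow> ('a \<Rightarrow> real) set" where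
  "subdifferential h a =
     (if \<bar>h a\<bar> \<noteq> \<infinity>
      then {l \<in> topological_dual. \<forall>x. h x \<ge> h a + ereal (l (x - a))}
      else {})"

definition finite_subsets :: "'i set \<Rightarrow> 'i set set" where
  "finite_subsets I = {J. J \<subseteq> I \<and> finite J \<and> J \<noteq> {}}"

definition robust_sum :: "'i set \<Rightarrow> ('i \<Rightarrow> 'a \<Rightarrow> ereal) \<Rightarrow> 'a \<Rightarrow> ereal" where
  "robust_sum I f x = (SUP J\<in>finite_subsets I. \<Sum>i\<in>J. f i x)"

definition exact_subsets :: "'i set \<Rightarrow> ('i \<Rightarrow> 'a \<Rightarrow> ereal) \<Rightarrow> 'a \<Rightarrow> 'i set set" where
  "exact_subsets I f x =
     (if x \<in> eff_domain (robust_sum I f)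
      then {J \<in> finite_subsets I. (\<Sum>j\<in>J. f j x) = robust_sum I f x}
      else {})"

definition rp_inf ::
    "'i set \<Rightarrow> ('i \<Rightarrow> 'a::locally_convex_space \<Rightarrow> ereal) \<Rightarrow> ('a \<Rightarrow> real) \<Rightarrow> ereal" where
  "rp_inf I f l = (INF x. robust_sum I f x - ereal (l x))"

definition rp_sol ::
    "'i set \<Rightarrow> ('i \<Rightarrow> 'a::locally_convex_space \<Rightarrow> ereal) \<Rightarrow> ('a \<Rightarrow> real) \<Rightarrow> 'a set" where
  "rp_sol I f l = {x. robust_sum I f x - ereal (l x) = rp_inf I f l}"

text \<open>
  A family indexed by \<open>J\<close> is an extensional function on \<open>J\<close>, so that each family has exactly one
  representative. The sum of the functionals is taken pointwise.
\<close>

definition rd_feasible ::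
    "'i set \<Rightarrow> ('a::locally_convex_space \<Rightarrow> real) \<Rightarrow> ('i set \<times> ('i \<Rightarrow> 'a \<Rightarrow> real)) set" where
  "rd_feasible I l =
     {(J, y). J \<in> finite_subsets I \<and> y \<in> J \<rightarrow>\<^sub>E topological_dual \<and> (\<lambda>x. \<Sum>j\<in>J. y j x) = l}"

definition rd_sup ::
    "'i set \<Rightarrow> ('i \<Rightarrow> 'a::locally_convex_space \<Rightarrow> ereal) \<Rightarrow> ('a \<Rightarrow> real) \<Rightarrow> ereal" where
  "rd_sup I f l = (SUP (J, y)\<in>rd_feasible I l. - (\<Sum>j\<in>J. conjugate (f j) (y j)))"

definition rd_sol ::
    "'i set \<Rightarrow> ('i \<Rightarrow> 'a::locally_convex_space \<Rightarrow> ereal) \<Rightarrow> ('a \<Rightarrow> real) \<Rightarrow>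
     ('i set \<times> ('i \<Rightarrow> 'a \<Rightarrow> real)) set" where
  "rd_sol I f l =
     {(J, y) \<in> rd_feasible I l. - (\<Sum>j\<in>J. conjugate (f j) (y j)) = rd_sup I f l}"

end

theory Submission
  imports Defs
begin

text \<open>
  For \<open>(K, y)\<close> dual feasible, summing the Fenchel-Young inequalities of the \<open>f j\<close>, \<open>j \<in> K\<close>,
  and bounding the partial sum by the robust sum shows that the robust sum at \<open>x\<close> plus the sum
  of the conjugates is at least the value of the target functional at \<open>x\<close>, which is weak duality.
  Equality holds iff \<open>K\<close> is exact at \<open>x\<close> and every Fenchel-Young inequality is tight, that is,
  every \<open>y j\<close> is a subgradient. Without a duality gap, equality at \<open>x\<close> says exactly that the
  primal and the dual value agree, so that both points are optimal.
\<close>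

lemma proper_function_not_minfty: "proper_function h \<Longrightarrow> h x \<noteq> -\<infinity>"
  by (simp add: proper_function_def)

text \<open>A point of the effective domain gives a real lower bound for the supremum.\<close>

lemma conjugate_not_minfty:
  assumes "proper_function h"
  shows "conjugate h l \<noteq> -\<infinity>"
proof -
  obtain z where z: "h z < \<infinity>" "h z \<noteq> -\<infinity>"
    using assms by (auto simp: proper_function_def eff_domain_def)
  have "ereal (l z) - h z \<le> conjugate h l"
    unfolding conjugate_def by (rule SUP_upper) simp
  with z show ?thesis
    by (cases "h z") auto
qed

lemma fenchel_young:
  assumes "proper_function h"
  shows "ereal (l x) \<le> h x + conjugate h l"
proof -
  have "ereal (l x) - h x \<le> conjugate h l"
    unfolding conjugate_def by (rule SUP_upper) simp
  then show ?thesis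
    using proper_function_not_minfty[OF assms, of x]
    by (cases "h x"; cases "conjugate h l") (auto simp: algebra_simps)
qed

text \<open>Rearranged, the subgradient inequality says that \<open>l z - h z\<close> is largest at
  \<open>z = x\<close>, so that the supremum defining the conjugate is attained there.\<close>

lemma subdifferential_iff_fenchel_equality:
  assumes h: "proper_function h" and l: "l \<in> topological_dual"
  shows "l \<in> subdifferential h x \<longleftrightarrow> h x + conjugate h l = ereal (l x)"
proof
  have lin: "l (z - x) = l z - l x" for z
    using l by (simp add: topological_dual_def linear_diff)
  {
    assume "l \<in> subdifferential h x"
    then have fin: "\<bar>h x\<bar> \<noteq> \<infinity>" and sub: "\<And>z. h x + ereal (l (z - x)) \<le> h z"
      by (auto simp: subdifferential_def split: if_splits)
    have "ereal (l z) - h z \<le> ereal (l x) - h x" for z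
      using sub[of z] fin by (cases "h x"; cases "h z") (auto simp: lin)
    then have "conjugate h l \<le> ereal (l x) - h x"
      unfolding conjugate_def by (rule SUP_least)
    then have "h x + conjugate h l \<le> ereal (l x)"
      using fin by (cases "h x"; cases "conjugate h l") auto
    then show "h x + conjugate h l = ereal (l x)"
      using fenchel_young[OF h] by (rule antisym)
  next
    assume eq: "h x + conjugate h l = ereal (l x)"
    \<comment> \<open>The right-hand side is real, whereas \<open>h x = \<infinity>\<close> would
      make the sum infinite.\<close>
    then have fin: "\<bar>h x\<bar> \<noteq> \<infinity>"
      using proper_function_not_minfty[OF h, of x] by auto
    have "h x + ereal (l (z - x)) \<le> h z" for z
      using fenchel_young[OF h, of l z] eq fin
      by (cases "h x"; cases "conjugate h l"; cases "h z") (auto simp: lin)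
    with fin l show "l \<in> subdifferential h x"
      by (simp add: subdifferential_def)
  }
qed

lemma ereal_sum_not_minfty:
  fixes b :: "'i \<Rightarrow> ereal"
  assumes "\<And>i. i \<in> A \<Longrightarrow> b i \<noteq> -\<infinity>"
  shows "sum b A \<noteq> -\<infinity>"
  using assms by (induction A rule: infinite_finite_induct) auto

text \<open>Serves to split equality in the summed Fenchel-Young inequality into equality for each
  index. A finite total excludes terms \<open>\<infinity>\<close> and the lower bounds exclude
  \<open>-\<infinity>\<close>, so the claim reduces to real sums.\<close>

lemma ereal_sum_mono_inv:
  fixes a :: "'i \<Rightarrow> real" and b :: "'i \<Rightarrow> ereal"
  assumes A: "finite A" and le: "\<And>i. i \<in> A \<Longrightarrow> ereal (a i) \<le> b i"
    and eq: "sum b A = ereal (sum a A)" and i: "i \<in> A"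
  shows "b i = ereal (a i)"
proof -
  have fin: "b k = ereal (real_of_ereal (b k))" if "k \<in> A" for k
  proof -
    have "b k \<noteq> \<infinity>"
      using eq that A by (metis PInfty_neq_ereal(1) sum_Pinfty)
    moreover have "b k \<noteq> -\<infinity>"
      using le[OF that] by auto
    ultimately show ?thesis
      by (cases "b k") auto
  qed
  have "ereal (\<Sum>k\<in>A. real_of_ereal (b k)) = ereal (sum a A)"
    unfolding eq[symmetric] by (subst sum_ereal[symmetric]) (intro sum.cong fin[symmetric] refl)
  then have "sum a A = (\<Sum>k\<in>A. real_of_ereal (b k))"
    by simp
  moreover have "a k \<le> real_of_ereal (b k)" if "k \<in> A" for k
    using le[OF that] by (subst (asm) fin[OF that]) simp
  ultimately have "a i = real_of_ereal (b i)"
    using i A by (rule sum_mono_inv)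
  with fin[OF i] show ?thesis
    by simp
qed

context
  fixes I :: "'i set"
    and f :: "'i \<Rightarrow> 'a::locally_convex_space \<Rightarrow> ereal"
    and xbar :: "'a \<Rightarrow> real"
    and K :: "'i set"
    and y :: "'i \<Rightarrow> 'a \<Rightarrow> real"
  assumes proper: "\<forall>i\<in>I. proper_function (f i)"
    and feasible: "(K, y) \<in> rd_feasible I xbar"
begin

lemma feasible_index: "K \<in> finite_subsets I" "finite K" "\<And>j. j \<in> K \<Longrightarrow> proper_function (f j)"
  using proper feasible by (auto simp: rd_feasible_def finite_subsets_def)

lemma feasible_dual: "j \<in> K \<Longrightarrow> y j \<in> topological_dual"
  using feasible by (auto simp: rd_feasible_def)

lemma feasible_sum: "(\<Sum>j\<in>K. y j x) = xbar x"
  using feasible by (auto simp: rd_feasible_def fun_eq_iff)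

lemma partial_sum_le_robust_sum: "(\<Sum>j\<in>K. f j x) \<le> robust_sum I f x"
  unfolding robust_sum_def by (rule SUP_upper) (rule feasible_index)

lemma partial_sum_not_minfty: "(\<Sum>j\<in>K. f j x) \<noteq> -\<infinity>"
  by (intro ereal_sum_not_minfty proper_function_not_minfty feasible_index)

lemma robust_sum_not_minfty: "robust_sum I f x \<noteq> -\<infinity>"
  using partial_sum_le_robust_sum[of x] partial_sum_not_minfty[of x] by auto

lemma conjugate_sum_not_minfty: "(\<Sum>j\<in>K. conjugate (f j) (y j)) \<noteq> -\<infinity>"
  by (intro ereal_sum_not_minfty conjugate_not_minfty feasible_index)

lemma fenchel_young_sum:
  "ereal (xbar x) \<le> (\<Sum>j\<in>K. f j x) + (\<Sum>j\<in>K. conjugate (f j) (y j))"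
proof -
  have "ereal (xbar x) = (\<Sum>j\<in>K. ereal (y j x))"
    by (simp add: feasible_sum)
  also have "\<dots> \<le> (\<Sum>j\<in>K. f j x + conjugate (f j) (y j))"
    by (intro sum_mono fenchel_young feasible_index)
  finally show ?thesis
    by (simp add: sum.distrib)
qed

lemma weak_duality:
  "- (\<Sum>j\<in>K. conjugate (f j) (y j)) \<le> robust_sum I f x - ereal (xbar x)"
proof -
  have "ereal (xbar x) \<le> robust_sum I f x + (\<Sum>j\<in>K. conjugate (f j) (y j))"
    using fenchel_young_sum[of x] add_right_mono[OF partial_sum_le_robust_sum[of x]]
    by (rule order_trans)
  \<comment> \<open>Neither summand is \<open>-\<infinity>\<close>, so the conjugate sum may change
    sides even when a value is infinite.\<close>
  then show ?thesis
    using robust_sum_not_minfty[of x] conjugate_sum_not_minfty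
    by (cases "robust_sum I f x"; cases "\<Sum>j\<in>K. conjugate (f j) (y j)") auto
qed

text \<open>The difference form matches the definitions of \<open>rp_sol\<close> and
  \<open>rd_sol\<close>; the proof goes through the additive form, in which Fenchel-Young
  inequalities can be summed.\<close>

lemma exact_subgradients_iff_equal_values:
  "K \<in> exact_subsets I f x \<and> (\<forall>j\<in>K. y j \<in> subdifferential (f j) x) \<longleftrightarrow>
    - (\<Sum>j\<in>K. conjugate (f j) (y j)) = robust_sum I f x - ereal (xbar x)"
  (is "?opt \<longleftrightarrow> - ?C = _")
proof -
  have "?opt \<longleftrightarrow> robust_sum I f x + ?C = ereal (xbar x)"
  proof
    assume opt: ?opt
    have "(\<Sum>j\<in>K. f j x) + ?C = (\<Sum>j\<in>K. ereal (y j x))"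
      unfolding sum.distrib[symmetric]
      by (intro sum.cong refl)
        (use opt subdifferential_iff_fenchel_equality feasible_index feasible_dual in blast)
    moreover have "(\<Sum>j\<in>K. f j x) = robust_sum I f x"
      using opt by (auto simp: exact_subsets_def split: if_splits)
    ultimately show "robust_sum I f x + ?C = ereal (xbar x)"
      by (simp add: feasible_sum)
  next
    assume eq: "robust_sum I f x + ?C = ereal (xbar x)"
    \<comment> \<open>Squeeze: the left side lies between \<open>xbar x\<close> and
      \<open>robust_sum I f x + ?C\<close>, which coincide by \<open>eq\<close>.\<close>
    have "(\<Sum>j\<in>K. f j x) + ?C = ereal (xbar x)"
      using fenchel_young_sum[of x] add_right_mono[OF partial_sum_le_robust_sum[of x], of ?C] eq
      by auto
    then have "(\<Sum>j\<in>K. f j x + conjugate (f j) (y j)) = ereal (\<Sum>j\<in>K. y j x)"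
      by (simp add: sum.distrib feasible_sum)
    then have "f j x + conjugate (f j) (y j) = ereal (y j x)" if "j \<in> K" for j
      using that feasible_index
      by (intro ereal_sum_mono_inv[where A = K and a = "\<lambda>j. y j x"]) (auto intro: fenchel_young)
    then have sub: "\<forall>j\<in>K. y j \<in> subdifferential (f j) x"
      using subdifferential_iff_fenchel_equality feasible_index feasible_dual by blast
    have "x \<in> eff_domain (robust_sum I f)"
      using eq conjugate_sum_not_minfty by (auto simp: eff_domain_def)
    \<comment> \<open>Both sums with \<open>?C\<close> equal the same real number, so
      \<open>?C\<close> is finite and cancels.\<close>
    moreover have "(\<Sum>j\<in>K. f j x) = robust_sum I f x"
      using \<open>(\<Sum>j\<in>K. f j x) + ?C = ereal (xbar x)\<close> eq
        partial_sum_not_minfty[of x] conjugate_sum_not_minfty robust_sum_not_minfty[of x]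
      by (cases "robust_sum I f x"; cases ?C; cases "\<Sum>j\<in>K. f j x") auto
    ultimately show ?opt
      using sub feasible_index by (simp add: exact_subsets_def)
  qed
  \<comment> \<open>The forms would differ for \<open>?C = -\<infinity>\<close> and an infinite
    robust sum, a case excluded by properness.\<close>
  also have "\<dots> \<longleftrightarrow> - ?C = robust_sum I f x - ereal (xbar x)"
    using robust_sum_not_minfty[of x] conjugate_sum_not_minfty
    by (cases "robust_sum I f x"; cases ?C) auto
  finally show ?thesis .
qed

text \<open>The primal value at \<open>x\<close> is the common optimal value, so dual optimality of
  the pair means equality of its value with the one at \<open>x\<close>.\<close>

lemma rd_sol_iff_exact_subgradients:
  assumes "rp_inf I f xbar = rd_sup I f xbar" and "x \<in> rp_sol I f xbar"
  shows "(K, y) \<in> rd_sol I f xbar \<longleftrightarrow>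
    K \<in> exact_subsets I f x \<and> (\<forall>j\<in>K. y j \<in> subdifferential (f j) x)"
  unfolding exact_subgradients_iff_equal_values
  using assms feasible by (auto simp: rd_sol_def rp_sol_def)

text \<open>By weak duality the dual value of the pair bounds all primal values from below, and
  \<open>x\<close> attains this bound. This leads from (iv) back to (iii).\<close>

lemma exact_subgradients_imp_rp_sol:
  assumes "K \<in> exact_subsets I f x" and "\<forall>j\<in>K. y j \<in> subdifferential (f j) x"
  shows "x \<in> rp_sol I f xbar"
proof -
  have "robust_sum I f x - ereal (xbar x) = - (\<Sum>j\<in>K. conjugate (f j) (y j))"
    using assms exact_subgradients_iff_equal_values[of x] by metis
  also have "\<dots> \<le> rp_inf I f xbar"
    unfolding rp_inf_def by (intro INF_greatest weak_duality)
  finally have "robust_sum I f x - ereal (xbar x) \<le> rp_inf I f xbar" .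
  moreover have "rp_inf I f xbar \<le> robust_sum I f x - ereal (xbar x)"
    unfolding rp_inf_def by (rule INF_lower) simp
  ultimately show ?thesis
    by (simp add: rp_sol_def)
qed

end

theorem corollary4p2:
  fixes I :: "'i set"
    and f :: "'i \<Rightarrow> 'a::locally_convex_space \<Rightarrow> ereal"
    and xbar :: "'a \<Rightarrow> real"
    and J :: "'i set"
    and xs :: "'i \<Rightarrow> 'a \<Rightarrow> real"
  assumes "infinite I"
    and "\<forall>i\<in>I. proper_function (f i)"
    and "proper_function (robust_sum I f)"
    and "xbar \<in> topological_dual"
    and "(J, xs) \<in> rd_feasible I xbar"
    and "rp_sol I f xbar \<noteq> {}"
    and "rp_inf I f xbar = rd_sup I f xbar"
  shows
    "((J, xs) \<in> rd_sol I f xbar \<longleftrightarrow>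
       (\<forall>x\<in>rp_sol I f xbar. J \<in> exact_subsets I f x \<and> (\<forall>j\<in>J. xs j \<in> subdifferential (f j) x)))
     \<and>
     ((J, xs) \<in> rd_sol I f xbar \<longleftrightarrow>
       (\<exists>x\<in>rp_sol I f xbar. J \<in> exact_subsets I f x \<and> (\<forall>j\<in>J. xs j \<in> subdifferential (f j) x)))
     \<and>
     ((J, xs) \<in> rd_sol I f xbar \<longleftrightarrow>
       (\<exists>x. J \<in> exact_subsets I f x \<and> (\<forall>j\<in>J. xs j \<in> subdifferential (f j) x)))
     \<and>
     (\<forall>x\<in>rp_sol I f xbar.
       rd_sol I f xbar =
         {(K, y) \<in> rd_feasible I xbar.
            K \<in> exact_subsets I f x \<and> (\<forall>j\<in>K. y j \<in> subdifferential (f j) x)})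
     \<and>
     (\<exists>x\<in>rp_sol I f xbar.
       rd_sol I f xbar =
         {(K, y) \<in> rd_feasible I xbar.
            K \<in> exact_subsets I f x \<and> (\<forall>j\<in>K. y j \<in> subdifferential (f j) x)})
     \<and>
     (\<exists>x.
       rd_sol I f xbar =
         {(K, y) \<in> rd_feasible I xbar.
            K \<in> exact_subsets I f x \<and> (\<forall>j\<in>K. y j \<in> subdifferential (f j) x)})"
proof -
  let ?opt = "\<lambda>K y x. K \<in> exact_subsets I f x \<and> (\<forall>j\<in>K. y j \<in> subdifferential (f j) x)"
  note iff = rd_sol_iff_exact_subgradients[OF assms(2) _ assms(7)]
  have J: "(J, xs) \<in> rd_sol I f xbar \<longleftrightarrow> ?opt J xs x" if "x \<in> rp_sol I f xbar" for x
    using iff[OF assms(5) that] .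
  have sol: "x \<in> rp_sol I f xbar" if "?opt J xs x" for x
    using exact_subgradients_imp_rp_sol[OF assms(2,5)] that by blast
  have sets: "rd_sol I f xbar = {(K, y) \<in> rd_feasible I xbar. ?opt K y x}"
    if x: "x \<in> rp_sol I f xbar" for x
  proof -
    have "rd_sol I f xbar \<subseteq> rd_feasible I xbar"
      by (auto simp: rd_sol_def)
    then show ?thesis
      \<comment> \<open>The equivalence is applied to every feasible pair, not only to
        \<open>(J, xs)\<close>.\<close>
      using iff[OF _ x] by auto
  qed
  \<comment> \<open>Primal attainment keeps the universal statement (ii) from being vacuous and
    provides the witness for the existential ones.\<close>
  obtain x0 where x0: "x0 \<in> rp_sol I f xbar"
    using assms(6) by blast
  show ?thesis
  proof (intro conjI)
    show "(J, xs) \<in> rd_sol I f xbar \<longleftrightarrow> (\<forall>x\<in>rp_sol I f xbar. ?opt J xs x)"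
      using J x0 by blast
    show "(J, xs) \<in> rd_sol I f xbar \<longleftrightarrow> (\<exists>x\<in>rp_sol I f xbar. ?opt J xs x)"
      using J x0 by blast
    \<comment> \<open>A witness anywhere in the space is a primal solution by \<open>sol\<close>, so
      \<open>J\<close> applies to it.\<close>
    show "(J, xs) \<in> rd_sol I f xbar \<longleftrightarrow> (\<exists>x. ?opt J xs x)"
      using J x0 sol by blast
  qed (use sets x0 in blast)+
qed

end
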